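(* Let $a>0$ and let the real line be endowed with the double Gaussian density $$f(x)=\frac12\left(\frac{e^{-(x-1)^2/(2a^2)}}{a\sqrt{2\pi}}+\frac{e^{-(x+1)^2/(2a^2)}}{a\sqrt{2\pi}}\right).$$ Then every isoperimetric boundary for $f$ is a single point enclosing a ray; that is, for every $0<A<1$, every isoperimetric region of weighted length $A$ is a ray, whose boundary is a single point.
   Context: A region in $\mathbb{R}$ is a finite union of pairwise disjoint closed intervals of positive length (possibly unbounded). The weighted length of a region $L$ is $\int_L f\,dx$ (the total weighted length of the line is $1$). The boundary $B=\partial L$ is a finite set of points, and its weighted perimeter is $\sum_{x\in B} f(x)$. The region $L$ is isoperimetric if no other region of the same weighted length has a boundary of smaller weighted perimeter; then $B=\partial L$ is called an isoperimetric boundary enclosing $L$. Only weighted lengths strictly between $0$ and $1$ are considered. A ray is an interval of the form $(-\infty,s]$ or $[s,\infty)$. *)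

theory Defs
  imports "HOL-Analysis.Analysis"
begin

text \<open>Bounded, half-bounded and unbounded closed intervals are all covered; the two distinct
  points exclude the empty set and the degenerate intervals.\<close>

definition closed_interval :: "real set \<Rightarrow> bool" where
  "closed_interval I \<longleftrightarrow> is_interval I \<and> closed I \<and> (\<exists>x\<in>I. \<exists>y\<in>I. x < y)"

definition region :: "real set \<Rightarrow> bool" where
  "region L \<longleftrightarrow> (\<exists>C. finite C \<and> (\<forall>I\<in>C. closed_interval I) \<and> disjoint C \<and> L = \<Union>C)"

definition weighted_length :: "(real \<Rightarrow> real) \<Rightarrow> real set \<Rightarrow> real" where
  "weighted_length f L = (LINT x:L|lborel. f x)"

text \<open>The frontier of a region is finite, so the sum below is never the default value 0 of a sum
  over an infinite set.\<close>

definition weighted_perimeter :: "(real \<Rightarrow> real) \<Rightarrow> real set \<Rightarrow> real" where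
  "weighted_perimeter f L = (\<Sum>x\<in>frontier L. f x)"

definition isoperimetric :: "(real \<Rightarrow> real) \<Rightarrow> real set \<Rightarrow> bool" where
  "isoperimetric f L \<longleftrightarrow> region L \<and>
     \<not> (\<exists>L'. region L' \<and> weighted_length f L' = weighted_length f L \<and>
             weighted_perimeter f L' < weighted_perimeter f L)"

definition ray :: "real set \<Rightarrow> bool" where
  "ray L \<longleftrightarrow> (\<exists>s. L = {..s} \<or> L = {s..})"

definition double_gaussian :: "real \<Rightarrow> real \<Rightarrow> real" where
  "double_gaussian a x =
     1 / 2 * (exp (- ((x - 1)\<^sup>2 / (2 * a\<^sup>2))) / (a * sqrt (2 * pi)) +
              exp (- ((x + 1)\<^sup>2 / (2 * a\<^sup>2))) / (a * sqrt (2 * pi)))"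

end

theory Submission
  imports Defs "HOL-Probability.Distribution_Functions" "HOL-Probability.Distributions"
    "HOL-Real_Asymp.Real_Asymp"
begin

text \<open>Let \<open>F x\<close> be the mass of \<open>{..x}\<close> and let \<open>I (F x) = f x\<close>, the perimeter of a ray of given
  mass. By evenness \<open>I (1 - t) = I t\<close>, so if \<open>I (s + t) < I s + I t\<close> whenever \<open>s + t < 1\<close>, then every
  bounded interval, and by adding up components every region that is not a ray, has larger perimeter
  than a ray of the same mass.

  The derivative of \<open>I\<close> at \<open>F x\<close> is the slope \<open>g x = (tanh (x / a\<^sup>2) - x) / a\<^sup>2\<close> of \<open>ln f\<close>. For
  \<open>s + t \<le> 1/2\<close>, subadditivity holds because \<open>I t / t\<close> decreases there, that is, \<open>F\<close> is log-concave on
  the negative axis. Since \<open>f\<close> may be bimodal, \<open>I\<close> need not be concave beyond that. Instead,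
  \<open>F x + F y = 1/2\<close> forces \<open>x + y < -2\<close>, hence \<open>g x + g y > 0\<close>, so that \<open>I t - I (1/2 - t)\<close> increases on
  \<open>(0, 1/2)\<close>. Together with the monotonicity of \<open>I\<close> up to \<open>1/4\<close> this gives all remaining cases.\<close>

section \<open>A criterion for strict subadditivity on the unit interval\<close>

text \<open>Passing to complementary masses reduces everything to masses at most 1/2. There
  \<open>skew\<close> turns \<open>half\<close> into a reversed triangle inequality,
  \<open>diff\<close>, and each case below rests on \<open>half\<close> or on
  \<open>diff\<close>.\<close>

lemma strict_subadditive_of_half:
  fixes I :: "real \<Rightarrow> real"
  assumes pos: "\<And>t. 0 < t \<Longrightarrow> t < 1 \<Longrightarrow> 0 < I t"
    and sym: "\<And>t. 0 < t \<Longrightarrow> t < 1 \<Longrightarrow> I (1 - t) = I t"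
    and half: "\<And>s t. 0 < s \<Longrightarrow> 0 < t \<Longrightarrow> s + t \<le> 1/2 \<Longrightarrow> I (s + t) < I s + I t"
    and skew: "\<And>s t. 0 < s \<Longrightarrow> s < t \<Longrightarrow> t < 1/2 \<Longrightarrow> I s - I (1/2 - s) < I t - I (1/2 - t)"
    and cont: "isCont I (1/2)"
    and mono: "\<And>s t. 0 < s \<Longrightarrow> s < t \<Longrightarrow> t \<le> 1/4 \<Longrightarrow> I s < I t"
    and "0 < s" "0 < t" "s + t < 1"
  shows "I (s + t) < I s + I t"
proof -
  \<comment> \<open>This is the limit of \<open>skew\<close> as its smaller argument
    \<open>v\<close> tends to 0. No limit of \<open>I\<close> at 0 is assumed; positivity of
    \<open>I v\<close> takes its place. Comparing with \<open>t/2\<close> before \<open>t\<close>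
    keeps the inequality strict in the limit.\<close>
  have skew0: "I (1/2 - t) < I t + I (1/2)" if t: "0 < t" "t < 1/2" for t
  proof -
    have "((\<lambda>v. I (1/2 - v)) \<longlongrightarrow> I (1/2)) (at_right 0)"
      by (rule isCont_tendsto_compose[OF cont]) (auto intro!: tendsto_eq_intros)
    then have "((\<lambda>v. - I (1/2 - v)) \<longlongrightarrow> - I (1/2)) (at_right 0)"
      by (rule tendsto_minus)
    moreover have "\<forall>\<^sub>F v in at_right 0. - I (1/2 - v) \<le> I (t/2) - I (1/2 - t/2)"
      unfolding eventually_at_right_field
    proof (intro exI[of _ "t/2"] conjI allI impI)
      fix v :: real assume "0 < v" "v < t/2"
      then show "- I (1/2 - v) \<le> I (t/2) - I (1/2 - t/2)"
        using skew[of v "t/2"] pos[of v] t by simp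
    qed (use t in simp)
    ultimately have "- I (1/2) \<le> I (t/2) - I (1/2 - t/2)"
      by (rule tendsto_upperbound) simp
    also have "\<dots> < I t - I (1/2 - t)" using skew[of "t/2" t] t by simp
    finally show ?thesis by simp
  qed
  have diff: "I u < I s + I (u + s)" if "0 < s" "0 < u" "u + s \<le> 1/2" for s u
  proof (cases "u + s = 1/2")
    case True
    then have "u = 1/2 - s" by simp
    then show ?thesis using skew0[of s] that by simp
  next
    case False
    \<comment> \<open>With this \<open>v\<close>, \<open>1/2 - v = u + s\<close> and
      \<open>1/2 - (s + v) = u\<close>, so \<open>skew\<close> bounds \<open>I u - I (u + s)\<close>
      by \<open>I (s + v) - I v\<close>, which \<open>half\<close> bounds by
      \<open>I s\<close>.\<close>
    define v where "v = 1/2 - u - s"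
    have v: "0 < v" using False that v_def by simp
    have "I v - I (u + s) < I (s + v) - I u"
      using skew[of v "s + v"] v that by (simp add: v_def)
    moreover have "I (s + v) < I s + I v" using half[of s v] v that by (simp add: v_def)
    ultimately show ?thesis by simp
  qed
  show ?thesis using assms(7-9)
  proof (induction s t rule: linorder_wlog)
    case (sym s t)
    then show ?case by (simp add: add.commute)
  next
    case (le s t)
    define u where "u = 1 - s - t"
    have u: "0 < u" "I (s + t) = I u" using le sym[of u] by (auto simp: u_def algebra_simps)
    consider "s + t \<le> 1/2" | "t \<ge> 1/2" | "s + t > 1/2" "t < 1/2" "s \<ge> 1/4" | "t < 1/2" "s < 1/4" "s + t > 1/2"
      by linarith
    then show ?case
    proof cases
      case 1
      then show ?thesis using half le by auto
    next
      case 2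
      have "I u < I s + I (u + s)" using diff[of s u] u le 2 by (simp add: u_def)
      moreover have "I (u + s) = I t" using assms(2)[of t] le u by (simp add: u_def)
      ultimately show ?thesis using u by simp
    next
      case 3
      \<comment> \<open>The difference in \<open>skew\<close> changes sign under reflection in 1/4,
        so, being increasing, it is nonnegative to the right of 1/4.\<close>
      have le_compl: "I (1/2 - r) \<le> I r" if "1/4 \<le> r" "r < 1/2" for r
      proof (cases "1/2 - r = r")
        case True
        then show ?thesis by (simp only: order_refl)
      next
        case False
        then show ?thesis using skew[of "1/2 - r" r] that by simp
      qed
      have "I (s + t) = I ((1/2 - s) + (1/2 - t))" using u by (simp add: u_def algebra_simps)
      also have "\<dots> < I (1/2 - s) + I (1/2 - t)" using 3 le by (intro half) auto
      also have "\<dots> \<le> I s + I t" using le_compl 3 le by (intro add_mono) auto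
      finally show ?thesis .
    next
      case 4
      \<comment> \<open>Here \<open>t\<close> and \<open>u\<close> differ by less than
        \<open>s\<close>: \<open>u - t < s\<close> amounts to \<open>s + t > 1/2\<close>, and
        \<open>t - u < s\<close> to \<open>t < 1/2\<close>. As \<open>s < 1/4\<close>,
        \<open>mono\<close> replaces the difference by \<open>s\<close>.\<close>
      consider "t < u" | "u < t" | "u = t" by linarith
      then show ?thesis
      proof cases
        case 1
        have "I u < I t + I (u - t)" using half[of t "u - t"] 1 4 le by (simp add: u_def)
        also have "I (u - t) < I s" using 1 4 le by (intro mono) (auto simp: u_def)
        finally show ?thesis using u by simp
      next
        case 2
        have "I u < I (t - u) + I t" using diff[of "t - u" u] 2 4 u by simp
        also have "I (t - u) < I s" using 2 4 le by (intro mono) (auto simp: u_def)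
        finally show ?thesis using u by simp
      next
        case 3
        then show ?thesis using pos[of s] 4 le u by simp
      qed
    qed
  qed
qed

section \<open>Weighted length and the distribution function of a density\<close>

lemma weighted_length_Un:
  assumes "integrable lborel f" "A \<in> sets borel" "B \<in> sets borel" "A \<inter> B = {}"
  shows "weighted_length f (A \<union> B) = weighted_length f A + weighted_length f B"
proof -
  have "set_integrable lborel C f" if "C \<in> sets borel" for C
    using integrable_mult_indicator[of C lborel f] assms(1) that by (simp add: set_integrable_def)
  then show ?thesis unfolding weighted_length_def using assms by (intro set_integral_Un) auto
qed

lemma weighted_length_atMost_has_derivative:
  assumes "integrable lborel f" "continuous_on UNIV f"
  shows "((\<lambda>y. weighted_length f {..y}) has_real_derivative f x) (at x)"
proof -
  have int: "set_integrable lborel C f" if "C \<in> sets borel" for C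
    using integrable_mult_indicator[of C lborel f] assms(1) that by (simp add: set_integrable_def)
  \<comment> \<open>Splitting at \<open>x - 1\<close> leaves a constant plus an integral over a
    compact interval, to which the fundamental theorem of calculus applies near
    \<open>x\<close>.\<close>
  have eq: "weighted_length f {..y} = weighted_length f {..x-1} + integral {x-1..y} f" if "x-1 < y" for y
  proof -
    have "weighted_length f {..y} = weighted_length f ({..x-1} \<union> {x-1<..y})"
      using that by (intro arg_cong[where f="weighted_length f"]) auto
    also have "\<dots> = weighted_length f {..x-1} + weighted_length f {x-1<..y}"
      using assms by (intro weighted_length_Un) auto
    also have "weighted_length f {x-1<..y} = integral {x-1<..y} f"
      unfolding weighted_length_def using int by (intro set_borel_integral_eq_integral) auto
    also have "\<dots> = integral {x-1..y} f"
      by (rule integral_spike_set; rule negligible_subset[of "{x-1}"]) auto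
    finally show ?thesis .
  qed
  have "((\<lambda>y. integral {x-1..y} f) has_real_derivative f x) (at x within {x-1..x+1})"
    using assms by (intro integral_has_real_derivative) (auto intro: continuous_on_subset)
  then have "((\<lambda>y. weighted_length f {..x-1} + integral {x-1..y} f) has_real_derivative f x) (at x)"
    by (auto simp: at_within_Icc_at intro!: derivative_eq_intros)
  then show ?thesis
    by (rule DERIV_cong_ev[THEN iffD1, rotated -1])
      (auto simp: eq[symmetric] eventually_nhds intro!: exI[of _ "{x-1<..}"])
qed

text \<open>The function is the cumulative distribution function of the finite Borel measure with
  density \<open>f\<close>.\<close>

lemma weighted_length_atMost_at_bot:
  assumes "integrable lborel f" "\<And>x. 0 \<le> f x"
  shows "((\<lambda>y. weighted_length f {..y}) \<longlongrightarrow> 0) at_bot"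
proof -
  let ?M = "density lborel f"
  interpret finite_measure ?M
  proof (rule finite_measureI)
    have "emeasure ?M (space ?M) = ennreal (LINT x|lborel. f x)"
      using assms by (simp add: emeasure_density nn_integral_eq_integral)
    then show "emeasure ?M (space ?M) \<noteq> \<infinity>" by simp
  qed
  interpret finite_borel_measure ?M
    by unfold_locales simp
  have "cdf ?M = (\<lambda>y. weighted_length f {..y})"
  proof
    fix y
    have "cdf ?M y = (LINT x|?M. indicator {..y} x)" by (simp add: cdf_def)
    also have "\<dots> = weighted_length f {..y}"
      unfolding weighted_length_def set_lebesgue_integral_def
      using assms by (subst integral_density) (auto simp: mult.commute)
    finally show "cdf ?M y = weighted_length f {..y}" .
  qed
  then show ?thesis using cdf_lim_at_bot by simp
qed

text \<open>Instantiated twice: with the double Gaussian, and with the centred Gaussian whose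
  translates are its two summands.\<close>

locale symmetric_density =
  fixes f :: "real \<Rightarrow> real"
  assumes integrable_f: "integrable lborel f"
    and continuous_f: "continuous_on UNIV f"
    and f_pos: "0 < f x"
    and f_even: "f (- x) = f x"
    and weighted_length_UNIV: "weighted_length f UNIV = 1"
begin

definition F :: "real \<Rightarrow> real" where
  "F x = weighted_length f {..x}"

lemma F_deriv: "(F has_real_derivative f x) (at x)"
  using weighted_length_atMost_has_derivative[OF integrable_f continuous_f]
  by (simp add: F_def[abs_def])

lemma F_at_bot: "(F \<longlongrightarrow> 0) at_bot"
  using weighted_length_atMost_at_bot[OF integrable_f] f_pos
  by (simp add: F_def[abs_def] less_imp_le)

lemma F_strict_mono: "x < y \<Longrightarrow> F x < F y"
  by (rule DERIV_pos_imp_increasing) (auto intro!: exI[of _ "f _"] F_deriv f_pos)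

lemma F_less_iff: "F x < F y \<longleftrightarrow> x < y"
  using F_strict_mono[of x y] F_strict_mono[of y x] by (cases x y rule: linorder_cases) auto

lemma F_pos: "0 < F x"
  by (rule DERIV_pos_imp_increasing_at_bot[OF _ F_at_bot]) (auto intro!: exI[of _ "f _"] F_deriv f_pos)

lemma weighted_length_atLeast: "weighted_length f {x..} = F (- x)"
proof -
  have "weighted_length f {x..} = (LINT y|lborel. indicator {x..} (- y) *\<^sub>R f (- y))"
    unfolding weighted_length_def set_lebesgue_integral_def
    by (subst lborel_integral_real_affine[of "-1" _ 0]) auto
  also have "\<dots> = F (- x)"
    unfolding weighted_length_def set_lebesgue_integral_def F_def
    by (intro Bochner_Integration.integral_cong) (auto simp: f_even indicator_def)
  finally show ?thesis .
qed

lemma weighted_length_lessThan: "weighted_length f {..<x} = F x"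
proof -
  have "AE y in lborel. y \<noteq> x" using AE_lborel_singleton by auto
  then show ?thesis
    unfolding F_def weighted_length_def set_lebesgue_integral_def using integrable_f
    by (intro integral_cong_AE) (auto simp: indicator_def elim!: eventually_mono)
qed

lemma F_minus: "F (- x) = 1 - F x"
proof -
  have "weighted_length f ({..<x} \<union> {x..}) = weighted_length f {..<x} + weighted_length f {x..}"
    using integrable_f by (intro weighted_length_Un) auto
  moreover have "{..<x} \<union> {x..} = UNIV" by auto
  ultimately show ?thesis
    by (simp add: weighted_length_UNIV weighted_length_atLeast weighted_length_lessThan)
qed

lemma weighted_length_Icc:
  assumes "x \<le> y"
  shows "weighted_length f {x..y} = F y - F x"
proof -
  have "weighted_length f ({..<x} \<union> {x..y}) = weighted_length f {..<x} + weighted_length f {x..y}"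
    using integrable_f by (intro weighted_length_Un) auto
  moreover have "{..<x} \<union> {x..y} = {..y}" using assms by auto
  ultimately show ?thesis by (simp add: weighted_length_lessThan F_def)
qed

lemma F_less_1: "F x < 1"
  using F_minus[of x] F_pos[of "- x"] by simp

lemma F_0: "F 0 = 1/2"
  using F_minus[of 0] by simp

text \<open>The quantile function. Since \<open>F\<close> takes values strictly between 0 and 1
  only, \<open>Q t\<close> is unspecified for all other \<open>t\<close>.\<close>

definition Q :: "real \<Rightarrow> real" where
  "Q t = (THE x. F x = t)"

lemma Q_F [simp]: "Q (F x) = x"
proof -
  have "y = x" if "F y = F x" for y
    using that F_less_iff[of x y] F_less_iff[of y x] by linarith
  then show ?thesis unfolding Q_def by (intro the_equality) auto
qed

lemma F_Q [simp]:
  assumes "0 < t" "t < 1"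
  shows "F (Q t) = t"
proof -
  have ex: "\<exists>x. F x < u" if "0 < u" for u
    using order_tendstoD(2)[OF F_at_bot that] by (auto simp: eventually_at_bot_linorder)
  \<comment> \<open>Small values of \<open>F\<close> occur far to the left; reflecting such a point
    for \<open>1 - t\<close> gives a value above \<open>t\<close>.\<close>
  obtain x y where xy: "F x < t" "F y < 1 - t" using ex assms by (meson diff_gt_0_iff_gt)
  then have "t < F (- y)" by (simp add: F_minus)
  moreover have "continuous_on {x..-y} F"
    by (intro DERIV_continuous_on) (rule has_field_derivative_at_within, rule F_deriv)
  moreover have "x \<le> - y" using xy(1) calculation F_less_iff[of x "-y"] by simp
  ultimately obtain z where "F z = t" using IVT'[of F x t "-y"] xy by auto
  then show ?thesis using Q_F by auto
qed

lemma isCont_Q: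
  assumes "0 < t" "t < 1"
  shows "isCont Q t"
proof -
  have "isCont Q (F (Q t))"
    by (rule isCont_inverse_function[of 1]) (auto intro: DERIV_isCont F_deriv)
  then show ?thesis using assms by simp
qed

lemma Q_deriv:
  assumes "0 < t" "t < 1"
  shows "(Q has_real_derivative inverse (f (Q t))) (at t)"
  using assms F_deriv f_pos[of "Q t"] isCont_Q
  by (intro DERIV_inverse_function[of F _ _ _ 0 1]) auto

text \<open>The perimeter of the ray \<open>{..Q t}\<close> of mass \<open>t\<close>, for
  \<open>0 < t < 1\<close>; by evenness the right ray of mass \<open>t\<close> has the same
  perimeter.\<close>

definition profile :: "real \<Rightarrow> real" where
  "profile t = f (Q t)"

lemma profile_F [simp]: "profile (F x) = f x"
  by (simp add: profile_def)

lemma profile_pos: "0 < profile t"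
  by (simp add: profile_def f_pos)

lemma profile_symmetric:
  assumes "0 < t" "t < 1"
  shows "profile (1 - t) = profile t"
  using F_minus[of "Q t"] profile_F[of "- Q t"] assms by (simp add: f_even profile_def)

end

section \<open>Perimeters of intervals and of regions\<close>

text \<open>In the list of all shapes of real intervals, those that omit a finite endpoint are not
  closed, because that endpoint lies in the closure; two distinct points rule out the rest.\<close>

lemma closed_interval_cases:
  assumes "closed_interval I"
  obtains "I = UNIV" | s where "I = {..s}" | s where "I = {s..}" | p q where "p < q" "I = {p..q}"
proof -
  obtain x y where xy: "x \<in> I" "y \<in> I" "x < y" and I: "is_interval I" "closure I = I"
    using assms by (auto simp: closed_interval_def)
  obtain a b where ab: "I = {} \<or> I = UNIV \<or> I = {..<b} \<or> I = {..b} \<or> I = {a<..} \<or> I = {a..} \<or>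
      I = {a<..<b} \<or> I = {a<..b} \<or> I = {a..<b} \<or> I = {a..b}"
    using is_real_interval[OF I(1)] by (elim exE)
  have neqI: "S \<noteq> T" if "c \<in> S" "c \<notin> T" for c :: real and S T
    using that by auto
  have half_line: "closure {..<b} \<noteq> {..<b}" "closure {a<..} \<noteq> {a<..}"
    by (rule neqI[of b], simp_all, rule neqI[of a], simp_all)
  have bounded: "closure {a<..<b} \<noteq> {a<..<b}" "closure {a<..b} \<noteq> {a<..b}" "closure {a..<b} \<noteq> {a..<b}" if "a < b"
    by (rule neqI[of a], use that in simp_all, rule neqI[of a], use that in simp_all,
        rule neqI[of b], use that in simp_all)
  consider "I = UNIV \<or> I = {..b} \<or> I = {a..}"
    | "I = {..<b} \<or> I = {a<..}"
    | "I = {a<..<b} \<or> I = {a<..b} \<or> I = {a..<b}"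
    | "I = {a..b}"
    using ab xy(1) by (elim disjE) simp_all
  then show thesis
  proof cases
    case 1
    then show thesis using that by (elim disjE) simp_all
  next
    case 2
    then show thesis using half_line I(2) by (elim disjE) simp_all
  next
    case 3
    moreover from this have "a < b" using xy by (elim disjE) simp_all
    ultimately show thesis using bounded I(2) by (elim disjE) simp_all
  next
    case 4
    then show thesis using xy that(4)[of a b] by simp
  qed
qed

text \<open>Removing the closed set \<open>B\<close> from the interior of
  \<open>A \<union> B\<close> leaves an open subset of \<open>A\<close>. Hence disjoint closed sets
  create no new interior points when united.\<close>

lemma frontier_Un_disjoint_closed:
  assumes "closed A" "closed B" "A \<inter> B = {}"
  shows "frontier (A \<union> B) = frontier A \<union> frontier B"
proof -
  have *: "interior (A \<union> B) - B \<subseteq> interior A" if "closed B" for A B :: "'a set"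
    using that interior_subset[of "A \<union> B"] by (intro interior_maximal open_Diff) auto
  have "interior (A \<union> B) = interior A \<union> interior B"
    using *[of B A] *[of A B] assms interior_subset[of "A \<union> B"]
      interior_mono[of A "A \<union> B"] interior_mono[of B "A \<union> B"] by (auto simp: Un_commute)
  then show ?thesis
    using assms interior_subset[of A] interior_subset[of B] by (auto simp: frontier_def)
qed

context symmetric_density
begin

lemma weighted_length_nonneg: "0 \<le> weighted_length f A"
  unfolding weighted_length_def set_lebesgue_integral_def
  using f_pos by (intro Bochner_Integration.integral_nonneg) (simp add: less_imp_le)

lemma interval_perimeter:
  assumes subadd: "\<And>s t. 0 < s \<Longrightarrow> 0 < t \<Longrightarrow> s + t < 1 \<Longrightarrow>
      profile (s + t) < profile s + profile t"
    and I: "closed_interval I" and less_1: "weighted_length f I < 1"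
  shows "0 < weighted_length f I \<and> finite (frontier I) \<and>
    (ray I \<and> weighted_perimeter f I = profile (weighted_length f I) \<or>
      profile (weighted_length f I) < weighted_perimeter f I)"
  using I
proof (cases rule: closed_interval_cases)
  case 1
  then show ?thesis using less_1 weighted_length_UNIV by simp
next
  case (2 s)
  then have "weighted_length f I = F s" by (simp add: F_def)
  then show ?thesis using 2 F_pos by (auto simp: weighted_perimeter_def ray_def)
next
  case (3 s)
  then show ?thesis using F_pos by (auto simp: weighted_perimeter_def ray_def weighted_length_atLeast f_even)
next
  case (4 p q)
  have fr: "frontier I = {p, q}" using 4 by (auto simp: frontier_def)
  have len: "weighted_length f I = F q - F p" using 4 by (simp add: weighted_length_Icc)
  \<comment> \<open>The complement of \<open>{p..q}\<close> consists, up to endpoints, of two rays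
    of masses \<open>F p\<close> and \<open>F (- q)\<close>. Subadditivity for these masses compares
    the profile with the two boundary values of \<open>f\<close>.\<close>
  have "profile (F q - F p) = profile (1 - (F q - F p))"
    using F_strict_mono[OF 4(1)] F_less_1[of q] F_pos[of p] by (intro profile_symmetric[symmetric]) auto
  also have "1 - (F q - F p) = F p + F (- q)" by (simp add: F_minus)
  also have "profile \<dots> < profile (F p) + profile (F (- q))"
    using F_strict_mono[OF 4(1)] F_pos F_less_1 F_minus[of q] by (intro subadd) auto
  also have "\<dots> = weighted_perimeter f I" using 4 fr by (simp add: weighted_perimeter_def f_even)
  finally show ?thesis using len fr F_strict_mono[OF 4(1)] by simp
qed

text \<open>Induction on the components: perimeters add up, while subadditivity of the profile is
  strict, so with two or more components only the strict alternative remains. Finiteness of the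
  frontier is carried along to split the sum over a union.\<close>

lemma region_perimeter:
  assumes subadd: "\<And>s t. 0 < s \<Longrightarrow> 0 < t \<Longrightarrow> s + t < 1 \<Longrightarrow>
      profile (s + t) < profile s + profile t"
    and "finite C" "C \<noteq> {}" "\<forall>I\<in>C. closed_interval I" "disjoint C"
    and "weighted_length f (\<Union>C) < 1"
  shows "0 < weighted_length f (\<Union>C) \<and> finite (frontier (\<Union>C)) \<and>
    (ray (\<Union>C) \<and> weighted_perimeter f (\<Union>C) = profile (weighted_length f (\<Union>C)) \<or>
      profile (weighted_length f (\<Union>C)) < weighted_perimeter f (\<Union>C))"
  using assms(2-)
proof (induction C rule: finite_ne_induct)
  case (singleton I)
  then show ?case using interval_perimeter[OF subadd, of I] by simp
next
  case (insert I C)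
  let ?U = "\<Union>C"
  have cl: "closed I" "closed ?U"
    using insert by (auto simp: closed_interval_def intro!: closed_Union)
  have disj: "disjoint C" "I \<inter> ?U = {}"
    using insert.prems(2) by (simp add: pairwise_insert)
      (use insert.hyps insert.prems(2) in \<open>auto simp: pairwise_insert disjnt_iff\<close>)
  have len: "weighted_length f (I \<union> ?U) = weighted_length f I + weighted_length f ?U"
    using cl disj integrable_f weighted_length_Un[of f I ?U] by (simp add: borel_closed)
  then have less_1: "weighted_length f I < 1" "weighted_length f ?U < 1"
    using insert.prems weighted_length_nonneg[of I] weighted_length_nonneg[of ?U] by auto
  have U: "0 < weighted_length f ?U" "finite (frontier ?U)" "profile (weighted_length f ?U) \<le> weighted_perimeter f ?U"
    using insert.IH insert.prems disj less_1 by auto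
  have I: "0 < weighted_length f I" "finite (frontier I)" "profile (weighted_length f I) \<le> weighted_perimeter f I"
    using interval_perimeter[OF subadd, of I] insert.prems less_1 by auto
  have fr: "frontier (I \<union> ?U) = frontier I \<union> frontier ?U"
    using frontier_Un_disjoint_closed[OF cl disj(2)] by simp
  have "frontier I \<inter> frontier ?U = {}"
    using cl disj frontier_subset_closed[of I] frontier_subset_closed[of ?U] by blast
  then have "weighted_perimeter f (I \<union> ?U) = weighted_perimeter f I + weighted_perimeter f ?U"
    unfolding weighted_perimeter_def fr using U I by (intro sum.union_disjoint) auto
  moreover have "profile (weighted_length f I + weighted_length f ?U)
      < profile (weighted_length f I) + profile (weighted_length f ?U)"
    using U I insert.prems(3) len by (intro subadd) auto
  ultimately show ?case using U I by (auto simp: len fr)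
qed

lemma isoperimetric_imp_ray:
  assumes subadd: "\<And>s t. 0 < s \<Longrightarrow> 0 < t \<Longrightarrow> s + t < 1 \<Longrightarrow>
      profile (s + t) < profile s + profile t"
    and L: "isoperimetric f L" and A: "0 < weighted_length f L" "weighted_length f L < 1"
  shows "ray L"
proof -
  obtain C where C: "finite C" "\<forall>I\<in>C. closed_interval I" "disjoint C" "L = \<Union>C"
    using L by (auto simp: isoperimetric_def region_def)
  have "C \<noteq> {}" using A C by (auto simp: weighted_length_def set_lebesgue_integral_def)
  \<comment> \<open>The competitor is the left ray of the same mass; minimality of \<open>L\<close>
    against it excludes the strict alternative of \<open>region_perimeter\<close>.\<close>
  define R where "R = {..Q (weighted_length f L)}"
  have "closed_interval R"
    unfolding closed_interval_def
  proof (intro conjI bexI)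
    show "Q (weighted_length f L) - 1 < Q (weighted_length f L)" by simp
  qed (auto simp: R_def is_interval_1)
  then have "region R" unfolding region_def by (intro exI[of _ "{R}"]) auto
  moreover have "weighted_length f R = weighted_length f L"
    using F_Q[OF A] by (simp add: R_def F_def)
  moreover have "weighted_perimeter f R = profile (weighted_length f L)"
    by (simp add: R_def weighted_perimeter_def profile_def)
  ultimately have "\<not> profile (weighted_length f L) < weighted_perimeter f L"
    using L by (auto simp: isoperimetric_def)
  then show ?thesis using region_perimeter[OF subadd C(1) \<open>C \<noteq> {}\<close> C(2,3)] C(4) A by auto
qed

end

section \<open>The double Gaussian and its logarithmic slope\<close>

lemma symmetric_density_normal:
  assumes "0 < a"
  shows "symmetric_density (normal_density 0 a)"
proof
  show "integrable lborel (normal_density 0 a)" "0 < normal_density 0 a x" for x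
    using assms by (auto simp: normal_density_pos)
  show "continuous_on UNIV (normal_density 0 a)"
    unfolding normal_density_def[abs_def] using assms by (intro continuous_intros) auto
  show "normal_density 0 a (- x) = normal_density 0 a x" for x
    by (simp add: normal_density_def)
  show "weighted_length (normal_density 0 a) UNIV = 1"
    using assms by (simp add: weighted_length_def set_lebesgue_integral_def)
qed

lemma double_gaussian_eq_normal:
  assumes "0 < a"
  shows "double_gaussian a = (\<lambda>x. (normal_density 1 a x + normal_density (-1) a x) / 2)"
  using assms by (simp add: fun_eq_iff double_gaussian_def normal_density_def real_sqrt_mult mult.commute add_divide_distrib)

lemma symmetric_density_double_gaussian:
  assumes "0 < a"
  shows "symmetric_density (double_gaussian a)"
proof
  show "integrable lborel (double_gaussian a)"
    using assms by (auto simp: double_gaussian_eq_normal)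
  show "continuous_on UNIV (double_gaussian a)"
    unfolding double_gaussian_def[abs_def] using assms by (intro continuous_intros) auto
  show "0 < double_gaussian a x" for x
    using assms by (auto simp: double_gaussian_def intro!: add_pos_pos)
  show "double_gaussian a (- x) = double_gaussian a x" for x
  proof -
    have "(- x - 1)\<^sup>2 = (x + 1)\<^sup>2" "(- x + 1)\<^sup>2 = (x - 1)\<^sup>2" by (auto simp: power2_eq_square algebra_simps)
    then show ?thesis by (simp add: double_gaussian_def)
  qed
  show "weighted_length (double_gaussian a) UNIV = 1"
    using assms by (simp add: weighted_length_def set_lebesgue_integral_def double_gaussian_eq_normal)
qed

definition double_gaussian_slope :: "real \<Rightarrow> real \<Rightarrow> real" where
  "double_gaussian_slope a x = (tanh (x / a\<^sup>2) - x) / a\<^sup>2"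

lemma double_gaussian_deriv:
  assumes "0 < a"
  shows "(double_gaussian a has_real_derivative double_gaussian_slope a x * double_gaussian a x) (at x)"
proof -
  \<comment> \<open>Expanding the squares extracts a common Gaussian factor and leaves a hyperbolic
    cosine, whose logarithmic derivative is the \<open>tanh\<close> term of the slope.\<close>
  have eq: "double_gaussian a = (\<lambda>x. exp (- (x\<^sup>2 + 1) / (2 * a\<^sup>2)) * cosh (x / a\<^sup>2) / (a * sqrt (2 * pi)))"
  proof
    fix x
    have "exp (- ((x - 1)\<^sup>2 / (2 * a\<^sup>2))) = exp (- (x\<^sup>2 + 1) / (2 * a\<^sup>2)) * exp (x / a\<^sup>2)"
      unfolding exp_add[symmetric] using assms by (intro arg_cong[where f=exp]) (simp add: field_simps power2_eq_square)
    moreover have "exp (- ((x + 1)\<^sup>2 / (2 * a\<^sup>2))) = exp (- (x\<^sup>2 + 1) / (2 * a\<^sup>2)) * exp (- (x / a\<^sup>2))"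
      unfolding exp_add[symmetric] using assms by (intro arg_cong[where f=exp]) (simp add: field_simps power2_eq_square)
    ultimately show "double_gaussian a x = exp (- (x\<^sup>2 + 1) / (2 * a\<^sup>2)) * cosh (x / a\<^sup>2) / (a * sqrt (2 * pi))"
      using assms unfolding double_gaussian_def cosh_def by (simp add: field_simps)
  qed
  define d where "d = a\<^sup>2"
  define k where "k = a * sqrt (2 * pi)"
  have "d \<noteq> 0" "k \<noteq> 0" using assms by (auto simp: d_def k_def)
  have "cosh (x / d) \<noteq> 0" using cosh_real_pos[of "x / d"] by linarith
  then have sinh: "sinh (x / d) = tanh (x / d) * cosh (x / d)" by (simp add: tanh_def)
  have "(tanh (x / d) - x) / d * (exp (- (x\<^sup>2 + 1) / (2 * d)) * cosh (x / d) / k) =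
      exp (- (x\<^sup>2 + 1) / (2 * d)) * (sinh (x / d) / d - x / d * cosh (x / d)) / k"
    unfolding sinh by (simp add: diff_divide_distrib algebra_simps)
  moreover have "((\<lambda>x. exp (- (x\<^sup>2 + 1) / (2 * d)) * cosh (x / d) / k) has_real_derivative
      exp (- (x\<^sup>2 + 1) / (2 * d)) * (sinh (x / d) / d - x / d * cosh (x / d)) / k) (at x)"
    using \<open>d \<noteq> 0\<close> \<open>k \<noteq> 0\<close>
    by (auto intro!: derivative_eq_intros simp: field_simps power2_eq_square)
  ultimately show ?thesis
    unfolding eq double_gaussian_slope_def d_def[symmetric] k_def[symmetric] by (simp only:)
qed

lemma double_gaussian_at_bot:
  assumes "0 < a"
  shows "(double_gaussian a \<longlongrightarrow> 0) at_bot"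
proof -
  define k c where "k = 1 / (2 * a\<^sup>2)" and "c = a * sqrt (2 * pi)"
  have "0 < k" "0 < c" using assms by (auto simp: k_def c_def)
  moreover have "double_gaussian a = (\<lambda>x. 1/2 * (exp (- (k * (x - 1)\<^sup>2)) / c + exp (- (k * (x + 1)\<^sup>2)) / c))"
    by (simp add: fun_eq_iff double_gaussian_def k_def c_def)
  ultimately show ?thesis by simp real_asymp
qed

text \<open>The slope vanishes at 0, so a positive value at \<open>x < 0\<close> forces a negative
  derivative at some \<open>z\<close> between them. On the negative axis the derivative is
  nondecreasing, as \<open>tanh\<close> squared is nonincreasing there; hence it is negative
  everywhere left of \<open>z\<close>.\<close>

lemma double_gaussian_slope_antimono:
  assumes "0 < a" "x \<le> 0" "0 < double_gaussian_slope a x" "y < x"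
  shows "double_gaussian_slope a x < double_gaussian_slope a y"
proof -
  let ?g = "double_gaussian_slope a"
  define g' where "g' w = ((1 - (tanh (w / a\<^sup>2))\<^sup>2) / a\<^sup>2 - 1) / a\<^sup>2" for w
  have der: "(?g has_real_derivative g' w) (at w)" for w
  proof -
    have "cosh (w / a\<^sup>2) \<noteq> 0" using cosh_real_pos[of "w / a\<^sup>2"] by linarith
    then show ?thesis unfolding double_gaussian_slope_def[abs_def] g'_def using assms(1)
      by (auto intro!: derivative_eq_intros simp: field_simps power2_eq_square)
  qed
  have "x < 0" using assms by (cases "x = 0") (auto simp: double_gaussian_slope_def)
  then obtain z where z: "x < z" "z < 0" "?g 0 - ?g x = (0 - x) * g' z"
    using MVT2[of x 0 ?g g'] der by blast
  then have "(- x) * g' z < 0" using assms(3) by (simp add: double_gaussian_slope_def)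
  then have "g' z < 0" using \<open>x < 0\<close> by (simp add: mult_less_0_iff zero_less_mult_iff)
  moreover have "g' w \<le> g' z" if "w \<le> z" for w
  proof -
    have "tanh (w / a\<^sup>2) \<le> tanh (z / a\<^sup>2)" using that by (simp add: divide_right_mono)
    moreover have "tanh (z / a\<^sup>2) \<le> 0" using z by (simp add: divide_nonpos_nonneg)
    ultimately have "\<bar>tanh (z / a\<^sup>2)\<bar> \<le> \<bar>tanh (w / a\<^sup>2)\<bar>" by linarith
    then have "(tanh (z / a\<^sup>2))\<^sup>2 \<le> (tanh (w / a\<^sup>2))\<^sup>2" by (simp only: abs_le_square_iff)
    then show ?thesis unfolding g'_def by (intro divide_right_mono diff_mono) auto
  qed
  ultimately have "\<exists>D. (?g has_real_derivative D) (at w) \<and> D < 0" if "w \<le> x" for w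
    using der[of w] z that by (intro exI[of _ "g' w"]) (meson le_less_trans less_imp_le order_trans)
  then show ?thesis using assms(4) by (intro DERIV_neg_imp_decreasing[of y x]) auto
qed

section \<open>The profile of the double Gaussian\<close>

context
  fixes a :: real
  assumes a: "0 < a"
begin

interpretation N: symmetric_density "normal_density 0 a"
  using a by (rule symmetric_density_normal)

interpretation symmetric_density "double_gaussian a"
  using a by (rule symmetric_density_double_gaussian)

lemma double_gaussian_F_eq: "F x = (N.F (x - 1) + N.F (x + 1)) / 2"
proof -
  have *: "weighted_length (normal_density m a) {..x} = N.F (x - m)" for m
  proof -
    have "weighted_length (normal_density m a) {..x} =
      (LINT y|lborel. indicator {..x} (m + y) *\<^sub>R normal_density m a (m + y))"
      unfolding weighted_length_def set_lebesgue_integral_def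
      by (subst lborel_integral_real_affine[of 1 _ m]) auto
    also have "\<dots> = N.F (x - m)"
      unfolding weighted_length_def set_lebesgue_integral_def N.F_def
      by (intro Bochner_Integration.integral_cong) (auto simp: normal_density_def indicator_def)
    finally show ?thesis .
  qed
  have int: "set_integrable lborel {..x} (normal_density m a)" for m
    using integrable_mult_indicator[of "{..x}" lborel "normal_density m a"] a by (simp add: set_integrable_def)
  have "weighted_length (double_gaussian a) {..x} =
      (weighted_length (normal_density 1 a) {..x} + weighted_length (normal_density (-1) a) {..x}) / 2"
    using int a by (simp add: weighted_length_def double_gaussian_eq_normal set_integral_add)
  then show ?thesis by (simp add: F_def *)
qed

text \<open>If \<open>y = - 2 - x\<close> is the reflection of \<open>x\<close> in the mean \<open>-1\<close> of the left summand, then the left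
  summand contributes exactly \<open>1/2\<close> to \<open>F x + F y\<close> and the right one a positive amount.\<close>

lemma F_add_eq_half_imp_less:
  assumes "F x + F y = 1/2"
  shows "x + y < -2"
proof (rule ccontr)
  assume "\<not> x + y < -2"
  then have "F (- 2 - x) \<le> F y" using F_less_iff[of y "- 2 - x"] by linarith
  moreover have "- 2 - x + 1 = - (x + 1)" by simp
  then have "N.F (- 2 - x + 1) = 1 - N.F (x + 1)" by (simp only: N.F_minus)
  ultimately have "F x + F y \<ge> 1/2 + (N.F (x - 1) + N.F (- 2 - x - 1)) / 2"
    by (simp add: double_gaussian_F_eq field_simps)
  then show False using assms N.F_pos[of "x - 1"] N.F_pos[of "- 2 - x - 1"] by simp
qed

text \<open>The derivative of the density is slope times density, and the density cancels against
  the derivative of \<open>Q\<close>.\<close>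

lemma profile_deriv:
  assumes "0 < t" "t < 1"
  shows "(profile has_real_derivative double_gaussian_slope a (Q t)) (at t)"
proof -
  have "((\<lambda>t. double_gaussian a (Q t)) has_real_derivative
      double_gaussian_slope a (Q t) * double_gaussian a (Q t) * inverse (double_gaussian a (Q t))) (at t)"
    by (rule DERIV_chain2[OF double_gaussian_deriv[OF a] Q_deriv[OF assms]])
  moreover have "double_gaussian a (Q t) \<noteq> 0" using f_pos[of "Q t"] by simp
  ultimately show ?thesis by (simp add: profile_def[abs_def] mult.assoc)
qed

text \<open>This is log-concavity of \<open>F\<close>: the derivative of \<open>f / F\<close> has
  the sign of slope times \<open>F\<close> minus \<open>f\<close>. With the slope frozen at
  \<open>x\<close>, the difference \<open>D\<close> tends to 0 at minus infinity and increases up to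
  \<open>x\<close>.\<close>

lemma slope_mult_F_less:
  assumes "x \<le> 0"
  shows "double_gaussian_slope a x * F x < double_gaussian a x"
proof (cases "double_gaussian_slope a x \<le> 0")
  case True
  then show ?thesis using F_pos[of x] f_pos[of x] by (meson le_less_trans less_imp_le mult_nonpos_nonneg)
next
  case False
  define D where "D y = double_gaussian a y - double_gaussian_slope a x * F y" for y
  have der: "(D has_real_derivative (double_gaussian_slope a y - double_gaussian_slope a x) * double_gaussian a y) (at y)" for y
    unfolding D_def[abs_def]
    by (auto intro!: derivative_eq_intros double_gaussian_deriv[OF a] F_deriv simp: algebra_simps)
  have pos: "0 < (double_gaussian_slope a y - double_gaussian_slope a x) * double_gaussian a y" if "y < x" for y
    using double_gaussian_slope_antimono[OF a assms _ that] False f_pos[of y] by simp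
  have "(D \<longlongrightarrow> 0) at_bot"
    unfolding D_def[abs_def] using double_gaussian_at_bot[OF a] F_at_bot by (auto intro!: tendsto_eq_intros)
  \<comment> \<open>The derivative of \<open>D\<close> vanishes at \<open>x\<close> itself, so
    strict growth from minus infinity is first used up to \<open>x - 1\<close>, and the last stretch
    needs a positive derivative only in its interior.\<close>
  then have "0 < D (x - 1)"
  proof (rule DERIV_pos_imp_increasing_at_bot[rotated])
    show "\<exists>l. (D has_real_derivative l) (at y) \<and> 0 < l" if "y \<le> x - 1" for y
      using der[of y] pos[of y] that by auto
  qed
  also have "D (x - 1) < D x"
  proof (rule DERIV_pos_imp_increasing_open[of "x - 1" x D])
    show "\<exists>l. (D has_real_derivative l) (at y) \<and> 0 < l" if "x - 1 < y" "y < x" for y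
      using der pos that by blast
    show "continuous_on {x - 1..x} D"
      by (rule DERIV_continuous_on) (rule has_field_derivative_at_within, rule der)
  qed simp
  finally show ?thesis by (simp add: D_def)
qed

lemma Q_nonpos: "0 < t \<Longrightarrow> t \<le> 1/2 \<Longrightarrow> Q t \<le> 0"
  using F_less_iff[of 0 "Q t"] F_Q[of t] F_0 by linarith

lemma profile_add_less_of_half:
  assumes "0 < s" "0 < t" "s + t \<le> 1/2"
  shows "profile (s + t) < profile s + profile t"
proof -
  have ratio: "profile v / v < profile u / u" if "0 < u" "u < v" "v \<le> 1/2" for u v
  proof (rule DERIV_neg_imp_decreasing[OF that(2)])
    fix w assume w: "u \<le> w" "w \<le> v"
    have "((\<lambda>w. profile w / w) has_real_derivative
        (double_gaussian_slope a (Q w) * w - profile w) / (w * w)) (at w)"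
      using w that by (auto intro!: derivative_eq_intros profile_deriv)
    moreover have "double_gaussian_slope a (Q w) * w < profile w"
      using slope_mult_F_less[OF Q_nonpos[of w]] w that by (simp add: profile_def)
    ultimately show "\<exists>D. ((\<lambda>w. profile w / w) has_real_derivative D) (at w) \<and> D < 0"
      using w that by (intro exI conjI) (auto simp: divide_less_0_iff)
  qed
  \<comment> \<open>\<open>r\<close> lies below the ratios at \<open>s\<close> and \<open>t\<close>,
    so \<open>profile (s + t)\<close> splits into \<open>r * s\<close> and \<open>r * t\<close>,
    each below the corresponding profile value.\<close>
  define r where "r = profile (s + t) / (s + t)"
  have "r < profile s / s" "r < profile t / t" using ratio assms by (auto simp: r_def)
  then have "r * s < profile s" "r * t < profile t" using assms by (auto simp: field_simps)
  moreover have "profile (s + t) = r * (s + t)" using assms by (simp add: r_def)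
  then have "profile (s + t) = r * s + r * t" by (simp only: distrib_left)
  ultimately show ?thesis by linarith
qed

lemma profile_skew:
  assumes "0 < s" "s < t" "t < 1/2"
  shows "profile s - profile (1/2 - s) < profile t - profile (1/2 - t)"
proof (rule DERIV_pos_imp_increasing[OF assms(2)])
  fix w assume w: "s \<le> w" "w \<le> t"
  let ?x = "Q w" and ?y = "Q (1/2 - w)"
  have "((\<lambda>w. profile (1/2 - w)) has_real_derivative double_gaussian_slope a ?y * (- 1)) (at w)"
    by (rule DERIV_chain2[OF profile_deriv]) (use w assms in \<open>auto intro!: derivative_eq_intros\<close>)
  then have "((\<lambda>w. profile w - profile (1/2 - w)) has_real_derivative
      (double_gaussian_slope a ?x + double_gaussian_slope a ?y)) (at w)"
    using w assms by (auto intro!: derivative_eq_intros profile_deriv)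
  moreover have "double_gaussian_slope a ?x + double_gaussian_slope a ?y > 0"
  proof -
    have "?x + ?y < -2" using w assms by (intro F_add_eq_half_imp_less) simp
    \<comment> \<open>Each \<open>tanh\<close> exceeds -1, so their sum exceeds -2, and hence
      exceeds \<open>?x + ?y\<close>.\<close>
    then have "0 < (tanh (?x / a\<^sup>2) - ?x) + (tanh (?y / a\<^sup>2) - ?y)"
      using tanh_real_gt_neg1[of "?x / a\<^sup>2"] tanh_real_gt_neg1[of "?y / a\<^sup>2"] by linarith
    then show ?thesis using a by (simp add: double_gaussian_slope_def flip: add_divide_distrib)
  qed
  ultimately show "\<exists>D. ((\<lambda>w. profile w - profile (1/2 - w)) has_real_derivative D) (at w) \<and> 0 < D"
    by blast
qed

text \<open>At -1 the left summand has half its mass to the left and the right one some mass, so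
  \<open>F (- 1) > 1/4\<close>. Masses up to 1/4 thus have quantiles below -1, where
  \<open>tanh > -1\<close> makes the slope positive.\<close>

lemma profile_strict_mono:
  assumes "0 < s" "s < t" "t \<le> 1/4"
  shows "profile s < profile t"
proof (rule DERIV_pos_imp_increasing[OF assms(2)])
  fix w assume w: "s \<le> w" "w \<le> t"
  have "F (Q w) < F (- 1)"
    using w assms N.F_pos[of "- 2"] N.F_0 by (simp add: double_gaussian_F_eq[of "- 1"])
  then have "Q w < - 1" by (simp add: F_less_iff)
  then have "0 < double_gaussian_slope a (Q w)"
    using tanh_real_gt_neg1[of "Q w / a\<^sup>2"] a by (simp add: double_gaussian_slope_def)
  then show "\<exists>D. (profile has_real_derivative D) (at w) \<and> 0 < D"
    using profile_deriv[of w] w assms by auto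
qed

lemma double_gaussian_isoperimetric_imp_ray:
  assumes "isoperimetric (double_gaussian a) L"
    and "0 < weighted_length (double_gaussian a) L" "weighted_length (double_gaussian a) L < 1"
  shows "ray L"
proof (rule isoperimetric_imp_ray[OF _ assms])
  fix s t :: real assume "0 < s" "0 < t" "s + t < 1"
  then show "profile (s + t) < profile s + profile t"
    by (rule strict_subadditive_of_half[rotated -3])
      (auto intro: profile_pos profile_symmetric profile_add_less_of_half profile_skew
        profile_strict_mono DERIV_isCont[OF profile_deriv])
qed

end

theorem theorem3p16:
  fixes a A :: real and L :: "real set"
  assumes "a > 0"
    and "0 < A" and "A < 1"
    and "isoperimetric (double_gaussian a) L"
    and "weighted_length (double_gaussian a) L = A"
  shows "ray L \<and> (\<exists>s. frontier L = {s})"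
proof -
  have "ray L" using assms by (intro double_gaussian_isoperimetric_imp_ray) auto
  then show ?thesis by (auto simp: ray_def)
qed

end
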